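(* Let $\sigma>0$, $\alpha\in(0,1)$, let $p=p_N,\ q=q_N\in(0,1]$ satisfy $p>q>0$ and $p,q=\omega(\log N/N)$ as $N\to\infty$, and let $\mathcal{G}=(A,X)\sim\mathrm{CSBM}(N,p,q,\mu_1,\mu_2,\sigma^2)$. Let $a=Np/\log N$. With probability at least $1-O(1/N)$, it holds for all $1\le n\le N$ that $$\max\left\{\frac{\min\{a,2\}}{10}\left(\alpha^2+\frac{(1-\alpha)^{2n}}{(Np)^n}\right),\frac1N\right\}\sigma^2\le(\sigma^{\mathrm{APPNP}(n)})^2$$ and $$(\sigma^{\mathrm{APPNP}(n)})^2\le\min\left\{\left(\alpha\left(\sum_{k=0}^{n-1}(1-\alpha)^k\sqrt{(\sigma^{(k)})^2_{\mathrm{upper}}}\right)+(1-\alpha)^n\sqrt{(\sigma^{(n)})^2_{\mathrm{upper}}}\right)^2,\ \sigma^2\right\}.$$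
   Context: $\mathrm{CSBM}(N,p,q,\mu_1,\mu_2,\sigma^2)$ (Contextual Stochastic Block Model), $N$ even: the node set $[N]$ is split into two classes $\mathcal{C}_1,\mathcal{C}_2$ of size $N/2$. The symmetric adjacency matrix $A\in\{0,1\}^{N\times N}$ has independent Bernoulli entries $A_{uv}$, $u\le v$, with parameter $p$ if $u,v$ are in the same class and $q$ otherwise. Independently, $X\in\mathbb{R}^N$ has independent entries $X_v\sim\mathcal{N}(\mu_i,\sigma^2)$ for $v\in\mathcal{C}_i$, where $\mu_1<\mu_2$. $D=\mathrm{diag}(A\mathbf{1}_N)$ is the degree matrix (in the stated regime all degrees are positive with high probability; high-probability events are understood to include this). APPNP with teleportation probability $\alpha$ is defined by $h^{\mathrm{APPNP}(0)}=X$ and $h^{\mathrm{APPNP}(n+1)}=(1-\alpha)(D^{-1}A)h^{\mathrm{APPNP}(n)}+\alpha X$. $(\sigma^{\mathrm{APPNP}(n)})^2$ is the variance, given $A$, of $h^{\mathrm{APPNP}(n)}_v$ for a node $v$; the bounds are asserted for every node $v$. For integers $n\ge0$, $$(\sigma^{(n)})^2_{\mathrm{upper}}=\min\left\{\sum_{k=0}^{\lfloor n/2\rfloor}\frac{9}{\min\{a,2\}}(n-2k+1)^{2k}(Np)^{n-2k}\left(\frac{2}{N(p+q)}\right)^{2n-2k},\,1\right\}\sigma^2$$ (for $n=0$ this equals $\sigma^2$). The probability is over the random graph $A$. *)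

theory Defs
  imports "HOL-Probability.Probability" "HOL-Library.Landau_Symbols"
begin

text \<open>
  The node set is \<open>{..<N}\<close>. The first class is a set \<open>C \<subseteq> {..<N}\<close> of size \<open>N div 2\<close>, the second
  class is its complement \<open>{..<N} - C\<close>. Matrices and vectors over the nodes are functions on \<open>nat\<close>
  of which only the values at indices below \<open>N\<close> are used.
\<close>

definition csbm_edge_prob :: "nat set \<Rightarrow> real \<Rightarrow> real \<Rightarrow> nat \<Rightarrow> nat \<Rightarrow> real" where
  "csbm_edge_prob C p q u v = (if u \<in> C \<longleftrightarrow> v \<in> C then p else q)"

text \<open>
  The law of the adjacency matrix: independent Bernoulli entries at the positions \<open>u \<le> v\<close>
  (so self-loops are possible), extended symmetrically.
\<close>

definition csbm_graph :: "nat \<Rightarrow> nat set \<Rightarrow> real \<Rightarrow> real \<Rightarrow> (nat \<Rightarrow> nat \<Rightarrow> real) pmf" where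
  "csbm_graph N C p q =
     map_pmf (\<lambda>b u v. if u < N \<and> v < N then of_bool (b (min u v, max u v)) else 0)
       (Pi_pmf {(u, v). u \<le> v \<and> v < N} False
         (\<lambda>(u, v). bernoulli_pmf (csbm_edge_prob C p q u v)))"

definition csbm_features :: "nat \<Rightarrow> nat set \<Rightarrow> real \<Rightarrow> real \<Rightarrow> real \<Rightarrow> (nat \<Rightarrow> real) measure" where
  "csbm_features N C \<mu>1 \<mu>2 \<sigma> =
     PiM {..<N} (\<lambda>v. density lborel (normal_density (if v \<in> C then \<mu>1 else \<mu>2) \<sigma>))"

definition csbm ::
    "nat \<Rightarrow> nat set \<Rightarrow> real \<Rightarrow> real \<Rightarrow> real \<Rightarrow> real \<Rightarrow> real \<Rightarrow>
      ((nat \<Rightarrow> nat \<Rightarrow> real) \<times> (nat \<Rightarrow> real)) measure" where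
  "csbm N C p q \<mu>1 \<mu>2 \<sigma> =
     measure_pmf (csbm_graph N C p q) \<Otimes>\<^sub>M csbm_features N C \<mu>1 \<mu>2 \<sigma>"

definition node_degree :: "nat \<Rightarrow> (nat \<Rightarrow> nat \<Rightarrow> real) \<Rightarrow> nat \<Rightarrow> real" where
  "node_degree N A v = (\<Sum>u<N. A v u)"

text \<open>The sum is the \<open>v\<close>-th entry of \<open>(D\<^sup>-\<^sup>1 A) h\<close>, where \<open>h\<close> is the previous iterate
  (with value 0 in rows of degree 0).\<close>

primrec appnp ::
    "nat \<Rightarrow> real \<Rightarrow> (nat \<Rightarrow> nat \<Rightarrow> real) \<Rightarrow> (nat \<Rightarrow> real) \<Rightarrow> nat \<Rightarrow> nat \<Rightarrow> real" where
  "appnp N \<alpha> A X 0 = X"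
| "appnp N \<alpha> A X (Suc n) =
     (\<lambda>v. (1 - \<alpha>) * (\<Sum>u<N. A v u / node_degree N A v * appnp N \<alpha> A X n u) + \<alpha> * X v)"

text \<open>
  The first component of \<open>M\<close> being discrete, conditioning on its value \<open>A\<close> is conditioning on an
  event. It has positive probability for almost every \<open>A\<close>; for the other \<open>A\<close> the value is
  meaningless.
\<close>

definition variance_given :: "('a \<times> 'b) measure \<Rightarrow> 'a \<Rightarrow> ('a \<times> 'b \<Rightarrow> real) \<Rightarrow> real" where
  "variance_given M A f =
     prob_space.variance (uniform_measure M {\<omega> \<in> space M. fst \<omega> = A}) f"

definition appnp_variance ::
    "nat \<Rightarrow> nat set \<Rightarrow> real \<Rightarrow> real \<Rightarrow> real \<Rightarrow> real \<Rightarrow> real \<Rightarrow> real \<Rightarrow>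
      (nat \<Rightarrow> nat \<Rightarrow> real) \<Rightarrow> nat \<Rightarrow> nat \<Rightarrow> real" where
  "appnp_variance N C p q \<mu>1 \<mu>2 \<sigma> \<alpha> A n v =
     variance_given (csbm N C p q \<mu>1 \<mu>2 \<sigma>) A (\<lambda>(A', X). appnp N \<alpha> A' X n v)"

definition degree_ratio :: "nat \<Rightarrow> real \<Rightarrow> real" where
  "degree_ratio N p = real N * p / ln (real N)"

definition var_upper :: "nat \<Rightarrow> real \<Rightarrow> real \<Rightarrow> real \<Rightarrow> nat \<Rightarrow> real" where
  "var_upper N p q \<sigma> n =
     min (\<Sum>k = 0..n div 2.
            9 / min (degree_ratio N p) 2 * real (n - 2 * k + 1) ^ (2 * k)
              * (real N * p) ^ (n - 2 * k) * (2 / (real N * (p + q))) ^ (2 * n - 2 * k))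
         1 * \<sigma>\<^sup>2"

text \<open>The sequence \<open>p\<^sub>N\<close>, \<open>q\<^sub>N\<close> is indexed by even \<open>N\<close>; limits are taken along this filter.\<close>

abbreviation even_at_top :: "nat filter" where
  "even_at_top \<equiv> inf at_top (principal {N. even N})"

end

theory Submission
  imports Defs
begin

text \<open>
  Given \<open>A\<close>, the variance at \<open>v\<close> is \<open>\<sigma>\<^sup>2\<close> times the squared norm of the \<open>v\<close>-th row of
  \<open>\<Sum>k<n. \<alpha> (1 - \<alpha>)^k P^k + (1 - \<alpha>)^n P^n\<close>, where \<open>P = D\<^sup>-\<^sup>1 A\<close>. This row is a probability vector,
  it has an entry at least \<open>\<alpha>\<close> at \<open>v\<close>, and apart from the teleportation mass \<open>\<alpha>\<close> at \<open>v\<close> all its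
  entries are at most \<open>1 / d\<close>, where \<open>d\<close> is the minimal degree. Hence its squared norm lies between
  \<open>\<alpha>\<^sup>2\<close> and \<open>\<alpha>\<^sup>2 + 1 / d\<close>. A Chernoff bound for the neighbours in the same class gives
  \<open>d \<ge> N p / 8\<close> for all nodes with probability at least \<open>1 - 1 / N\<close>. As \<open>N p\<close> tends to infinity,
  the claimed lower bound is eventually at most \<open>max (\<alpha>\<^sup>2) (1 / N)\<close>, and the claimed upper bound exceeds
  \<open>\<alpha>\<^sup>2\<close> by at least the cross term of \<open>k = 0\<close> and \<open>k = 1\<close>, which is of the larger order
  \<open>1 / sqrt (N p)\<close>, so no count of longer walks is needed.
\<close>

section \<open>Rows of the APPNP weight matrix\<close>

text \<open>A recursion parallel to that of \<open>appnp\<close> stands in for the closed form in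
  powers of \<open>P\<close>, so that the two unfold in step.\<close>

primrec appnp_weight :: "nat \<Rightarrow> real \<Rightarrow> (nat \<Rightarrow> nat \<Rightarrow> real) \<Rightarrow> nat \<Rightarrow> nat \<Rightarrow> nat \<Rightarrow> real" where
  "appnp_weight N \<alpha> A 0 = (\<lambda>v u. of_bool (u = v))"
| "appnp_weight N \<alpha> A (Suc n) = (\<lambda>v u.
     (1 - \<alpha>) * (\<Sum>w<N. A v w / node_degree N A v * appnp_weight N \<alpha> A n w u)
       + \<alpha> * of_bool (u = v))"

text \<open>The weights depend on \<open>A\<close> alone, so given \<open>A\<close> each iterate is
  a fixed linear combination of independent Gaussians.\<close>

lemma appnp_eq_weighted_sum:
  assumes "v < N"
  shows "appnp N \<alpha> A X n v = (\<Sum>u<N. appnp_weight N \<alpha> A n v u * X u)"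
  using assms
proof (induction n arbitrary: v)
  case 0
  then show ?case by (simp add: of_bool_def if_distrib[of "\<lambda>x. x * _"] cong: if_cong)
next
  case (Suc n)
  have "(\<Sum>w<N. A v w / node_degree N A v * (\<Sum>u<N. appnp_weight N \<alpha> A n w u * X u))
      = (\<Sum>w<N. \<Sum>u<N. A v w / node_degree N A v * appnp_weight N \<alpha> A n w u * X u)"
    by (simp add: sum_distrib_left mult.assoc)
  also have "\<dots> = (\<Sum>u<N. (\<Sum>w<N. A v w / node_degree N A v * appnp_weight N \<alpha> A n w u) * X u)"
    by (subst sum.swap) (simp add: sum_distrib_right)
  finally have propagated:
    "(\<Sum>w<N. A v w / node_degree N A v * (\<Sum>u<N. appnp_weight N \<alpha> A n w u * X u))
      = (\<Sum>u<N. (\<Sum>w<N. A v w / node_degree N A v * appnp_weight N \<alpha> A n w u) * X u)" .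
  have "(\<Sum>u<N. \<alpha> * of_bool (u = v) * X u) = (\<Sum>u<N. if u = v then \<alpha> * X u else 0)"
    by (intro sum.cong) auto
  also have "\<dots> = \<alpha> * X v"
    using Suc.prems by simp
  finally have teleported: "(\<Sum>u<N. \<alpha> * of_bool (u = v) * X u) = \<alpha> * X v" .
  have "appnp N \<alpha> A X (Suc n) v
      = (1 - \<alpha>) * (\<Sum>u<N. (\<Sum>w<N. A v w / node_degree N A v * appnp_weight N \<alpha> A n w u) * X u)
        + (\<Sum>u<N. \<alpha> * of_bool (u = v) * X u)"
    using Suc.IH by (simp add: propagated[symmetric] teleported del: times_divide_eq_left)
  also have "\<dots> = (\<Sum>u<N. appnp_weight N \<alpha> A (Suc n) v u * X u)"
    unfolding sum_distrib_left[of "1 - \<alpha>"]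
    by (simp only: appnp_weight.simps sum.distrib distrib_right mult.assoc)
  finally show ?case .
qed

text \<open>The deterministic part: the row estimates see the random graph only through these
  bounds, later with \<open>d = N p / 8\<close>. The entry bounds range over all indices, since
  \<open>csbm_graph\<close> has value 0 outside the node set.\<close>

locale min_degree_graph =
  fixes N :: nat and A :: "nat \<Rightarrow> nat \<Rightarrow> real" and \<alpha> d :: real
  assumes adj_nonneg: "0 \<le> A v u" and adj_le_1: "A v u \<le> 1"
    and d_pos: "0 < d" and degree_ge: "v < N \<Longrightarrow> d \<le> node_degree N A v"
    and \<alpha>_nonneg: "0 \<le> \<alpha>" and \<alpha>_le_1: "\<alpha> \<le> 1"
begin

abbreviation "P v u \<equiv> A v u / node_degree N A v"
abbreviation "W \<equiv> appnp_weight N \<alpha> A"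

lemma degree_pos: "v < N \<Longrightarrow> 0 < node_degree N A v"
  using degree_ge d_pos by (meson less_le_trans)

lemma P_nonneg: "0 \<le> P v u"
  by (simp add: adj_nonneg node_degree_def sum_nonneg)

lemma sum_P: "v < N \<Longrightarrow> (\<Sum>u<N. P v u) = 1"
  using degree_pos[of v] by (simp add: sum_divide_distrib[symmetric] node_degree_def[symmetric])

lemma P_le: "v < N \<Longrightarrow> P v u \<le> 1 / d"
  using degree_ge[of v] d_pos by (intro frac_le) (auto simp: adj_le_1)

text \<open>Rows of \<open>P\<close> are probability vectors; this carries the entrywise bound
  \<open>1 / d\<close> through further steps of the walk.\<close>

lemma average_le:
  assumes "v < N" "\<And>w. w < N \<Longrightarrow> f w \<le> c"
  shows "(\<Sum>w<N. P v w * f w) \<le> c"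
proof -
  have "(\<Sum>w<N. P v w * f w) \<le> (\<Sum>w<N. P v w * c)"
    using assms(2) by (intro sum_mono mult_left_mono P_nonneg) auto
  also have "\<dots> = c"
    by (simp only: sum_distrib_right[symmetric] sum_P[OF assms(1)] mult_1)
  finally show ?thesis .
qed

lemma W_nonneg: "0 \<le> W n v u"
proof (induction n arbitrary: v)
  case (Suc n)
  show ?case
    using Suc P_nonneg \<alpha>_nonneg \<alpha>_le_1
    by (auto intro!: add_nonneg_nonneg mult_nonneg_nonneg sum_nonneg simp del: times_divide_eq_left)
qed simp

lemma sum_of_bool_eq: "v < N \<Longrightarrow> (\<Sum>u<N. of_bool (u = v)) = (1::real)"
  by (simp add: of_bool_def)

lemma sum_W: "v < N \<Longrightarrow> (\<Sum>u<N. W n v u) = 1"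
proof (induction n arbitrary: v)
  case 0
  then show ?case by (simp add: sum_of_bool_eq)
next
  case (Suc n)
  have "(\<Sum>u<N. \<Sum>w<N. P v w * W n w u) = (\<Sum>w<N. P v w * (\<Sum>u<N. W n w u))"
    by (subst sum.swap) (simp add: sum_distrib_left)
  also have "\<dots> = 1"
    using Suc.IH sum_P[OF Suc.prems] by simp
  finally have "(\<Sum>u<N. \<Sum>w<N. P v w * W n w u) = 1" .
  moreover have "(\<Sum>u<N. W (Suc n) v u)
      = (1 - \<alpha>) * (\<Sum>u<N. \<Sum>w<N. P v w * W n w u) + \<alpha> * (\<Sum>u<N. of_bool (u = v))"
    by (simp only: appnp_weight.simps sum.distrib sum_distrib_left)
  ultimately show ?case
    using sum_of_bool_eq[OF Suc.prems] by simp
qed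

lemma W_le_1: "v < N \<Longrightarrow> u < N \<Longrightarrow> W n v u \<le> 1"
  using member_le_sum[of u "{..<N}" "W n v"] sum_W[of v n] W_nonneg by simp

text \<open>In matrix form the next product is \<open>(1 - \<alpha>) P (P W) + \<alpha> P\<close>.
  The bound for \<open>P\<close> therefore passes to all \<open>n\<close>: averaging preserves it,
  and so does the convex combination.\<close>

lemma PW_le: "v < N \<Longrightarrow> u < N \<Longrightarrow> (\<Sum>w<N. P v w * W n w u) \<le> 1 / d"
proof (induction n arbitrary: v)
  case 0
  have "(\<Sum>w<N. P v w * W 0 w u) = (\<Sum>w<N. if u = w then P v w else 0)"
    by (intro sum.cong) auto
  also have "\<dots> = P v u"
    using 0 by simp
  finally show ?case
    using P_le[OF 0(1)] by simp
next
  case (Suc n)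
  define B where "B w = (\<Sum>w'<N. P w w' * W n w' u)" for w
  have "(\<Sum>w<N. P v w * of_bool (u = w)) = (\<Sum>w<N. if u = w then P v w else 0)"
    by (intro sum.cong) auto
  also have "\<dots> = P v u"
    using Suc.prems by simp
  finally have diag: "(\<Sum>w<N. P v w * of_bool (u = w)) = P v u" .
  have "(\<Sum>w<N. P v w * W (Suc n) w u)
      = (\<Sum>w<N. (1 - \<alpha>) * (P v w * B w) + \<alpha> * (P v w * of_bool (u = w)))"
    by (intro sum.cong refl) (simp only: appnp_weight.simps B_def distrib_left mult.left_commute)
  also have "\<dots> = (1 - \<alpha>) * (\<Sum>w<N. P v w * B w) + \<alpha> * P v u"
    by (simp only: sum.distrib sum_distrib_left[symmetric] diag)
  also have "\<dots> \<le> (1 - \<alpha>) * (1 / d) + \<alpha> * (1 / d)"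
    using Suc \<alpha>_nonneg \<alpha>_le_1
    by (intro add_mono mult_left_mono average_le P_le) (auto simp only: B_def diff_ge_0_iff_ge)
  also have "\<dots> = 1 / d"
    by (simp flip: distrib_right add_divide_distrib)
  finally show ?case .
qed

lemma sum_W_sq_le_1: "v < N \<Longrightarrow> (\<Sum>u<N. (W n v u)\<^sup>2) \<le> 1"
proof -
  assume v: "v < N"
  have "(\<Sum>u<N. (W n v u)\<^sup>2) \<le> (\<Sum>u<N. W n v u)"
    using v by (intro sum_mono) (simp add: power2_eq_square mult_left_le W_le_1 W_nonneg)
  then show ?thesis
    using sum_W[OF v] by simp
qed

text \<open>Cauchy-Schwarz against the all-ones vector, for a row of sum 1.\<close>

lemma sum_W_sq_ge_inverse:
  assumes "v < N"
  shows "1 / real N \<le> (\<Sum>u<N. (W n v u)\<^sup>2)"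
proof -
  have "(\<Sum>u<N. 1 * W n v u)\<^sup>2 \<le> (\<Sum>u<N. 1\<^sup>2) * (\<Sum>u<N. (W n v u)\<^sup>2)"
    by (rule Cauchy_Schwarz_ineq_sum)
  then show ?thesis
    using assms by (simp add: sum_W field_simps)
qed

text \<open>The diagonal entry suffices: the last update returns mass \<alpha> to
  \<open>v\<close>.\<close>

lemma sum_W_sq_ge_\<alpha>_sq:
  assumes "v < N" "0 < n"
  shows "\<alpha>\<^sup>2 \<le> (\<Sum>u<N. (W n v u)\<^sup>2)"
proof -
  obtain m where n: "n = Suc m"
    using \<open>0 < n\<close> gr0_implies_Suc by blast
  have "0 \<le> (1 - \<alpha>) * (\<Sum>w<N. P v w * W m w v)"
    using P_nonneg W_nonneg \<alpha>_le_1 by (intro mult_nonneg_nonneg sum_nonneg) auto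
  then have "\<alpha> \<le> W n v v"
    by (simp add: n)
  then have "\<alpha>\<^sup>2 \<le> (W n v v)\<^sup>2"
    using \<alpha>_nonneg by (intro power_mono)
  also have "\<dots> \<le> (\<Sum>u<N. (W n v u)\<^sup>2)"
    using assms by (intro member_le_sum) auto
  finally show ?thesis .
qed

text \<open>The row mixes the point mass at \<open>v\<close>, with weight \<alpha>, and a
  probability vector \<open>B\<close> whose entries are at most \<open>1 / d\<close>.\<close>

lemma sum_W_sq_le:
  assumes v: "v < N" and "0 < n"
  shows "(\<Sum>u<N. (W n v u)\<^sup>2) \<le> \<alpha>\<^sup>2 + 1 / d"
proof -
  obtain m where n: "n = Suc m"
    using \<open>0 < n\<close> gr0_implies_Suc by blast
  define B where "B u = (\<Sum>w<N. P v w * W m w u)" for u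
  have B: "0 \<le> B u" "u < N \<Longrightarrow> B u \<le> 1 / d" for u
    unfolding B_def using PW_le[OF v] P_nonneg W_nonneg
    by (auto intro!: sum_nonneg mult_nonneg_nonneg simp del: times_divide_eq_left)
  have "(\<Sum>u<N. B u) = (\<Sum>w<N. P v w * (\<Sum>u<N. W m w u))"
    unfolding B_def by (subst sum.swap) (simp add: sum_distrib_left)
  then have sum_B: "(\<Sum>u<N. B u) = 1"
    using sum_W sum_P[OF v] by simp
  \<comment> \<open>The squared norm is at most the bound on the entries times their sum.\<close>
  have "(\<Sum>u<N. (B u)\<^sup>2) \<le> (\<Sum>u<N. 1 / d * B u)"
    unfolding power2_eq_square using B by (intro sum_mono mult_right_mono) auto
  also have "\<dots> = 1 / d"
    by (simp only: sum_distrib_left[symmetric] sum_B)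
  finally have sum_B_sq: "(\<Sum>u<N. (B u)\<^sup>2) \<le> 1 / d" .
  have "(\<Sum>u<N. (W n v u)\<^sup>2) = (\<Sum>u<N. ((1 - \<alpha>) * B u + \<alpha> * of_bool (u = v))\<^sup>2)"
    by (simp add: n B_def)
  \<comment> \<open>Only the coordinate \<open>v\<close> has a cross term.\<close>
  also have "\<dots> = (\<Sum>u<N. (1 - \<alpha>)\<^sup>2 * (B u)\<^sup>2
      + (if u = v then \<alpha>\<^sup>2 + 2 * \<alpha> * (1 - \<alpha>) * B u else 0))"
    by (intro sum.cong) (auto simp: power2_eq_square algebra_simps)
  also have "\<dots> = (1 - \<alpha>)\<^sup>2 * (\<Sum>u<N. (B u)\<^sup>2) + (\<alpha>\<^sup>2 + 2 * \<alpha> * (1 - \<alpha>) * B v)"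
    using v by (simp add: sum.distrib sum_distrib_left)
  also have "\<dots> \<le> (1 - \<alpha>)\<^sup>2 * (1 / d) + (\<alpha>\<^sup>2 + 2 * \<alpha> * (1 - \<alpha>) * (1 / d))"
    using sum_B_sq B v \<alpha>_nonneg \<alpha>_le_1 by (intro add_mono mult_left_mono) auto
  also have "\<dots> = \<alpha>\<^sup>2 + (1 - \<alpha>\<^sup>2) * (1 / d)"
    using d_pos by (simp add: power2_eq_square field_simps)
  also have "\<dots> \<le> \<alpha>\<^sup>2 + 1 * (1 / d)"
    using d_pos by (intro add_left_mono mult_right_mono) auto
  finally show ?thesis by simp
qed

end

section \<open>The conditional variance\<close>

text \<open>The coordinates together form the identity of the product space, so their joint law is
  the product of the marginals, which characterises independence for nonempty
  \<open>I\<close>.\<close>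

lemma indep_vars_PiM_component:
  assumes "\<And>i. prob_space (M i)" "I \<noteq> {}"
  shows "prob_space.indep_vars (PiM I M) M (\<lambda>i \<omega>. \<omega> i) I"
proof -
  interpret prob_space "PiM I M"
    by (intro prob_space_PiM assms)
  have "distr (PiM I M) (PiM I M) (\<lambda>x. \<lambda>i\<in>I. x i) = distr (PiM I M) (PiM I M) (\<lambda>x. x)"
    by (intro distr_cong) (auto simp: space_PiM PiE_restrict)
  also have "\<dots> = PiM I (\<lambda>i. distr (PiM I M) (M i) (\<lambda>x. x i))"
    using assms by (simp add: distr_PiM_component cong: PiM_cong)
  finally show ?thesis
    using assms(2) by (subst indep_vars_iff_distr_eq_PiM') auto
qed

text \<open>A linear combination of independent normals is normal, and the squared scales add up.
  The nonzero weight at \<open>u0\<close> excludes the degenerate case.\<close>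

lemma variance_csbm_features:
  assumes "0 < \<sigma>" "u0 < N" "w u0 \<noteq> 0"
  shows "prob_space.variance (csbm_features N C \<mu>1 \<mu>2 \<sigma>) (\<lambda>X. \<Sum>u<N. w u * X u)
    = \<sigma>\<^sup>2 * (\<Sum>u<N. (w u)\<^sup>2)"
proof -
  define m where "m u = (if u \<in> C then \<mu>1 else \<mu>2)" for u
  define M where "M u = density lborel (normal_density (m u) \<sigma>)" for u
  have F: "csbm_features N C \<mu>1 \<mu>2 \<sigma> = PiM {..<N} M"
    by (simp add: csbm_features_def M_def[abs_def] m_def)
  have ps: "prob_space (M u)" for u
    unfolding M_def using assms(1) by (rule prob_space_normal_density)
  interpret prob_space "PiM {..<N} M"
    by (intro prob_space_PiM ps)
  \<comment> \<open>A zero weight gives a point mass, which has no normal density, so the sum is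
    restricted to the support of \<open>w\<close>.\<close>
  define I where "I = {u. u < N \<and> w u \<noteq> 0}"
  have I: "finite I" "I \<noteq> {}" "I \<subseteq> {..<N}"
    using assms by (auto simp: I_def)
  have sum_I: "(\<Sum>u\<in>I. w u * X u) = (\<Sum>u<N. w u * X u)" for X :: "nat \<Rightarrow> real"
    by (intro sum.mono_neutral_left) (auto simp: I_def)
  have [measurable_cong]: "sets (M u) = sets borel" for u
    by (simp add: M_def)
  have "indep_vars M (\<lambda>u X. X u) {..<N}"
    using assms ps by (intro indep_vars_PiM_component) auto
  then have "indep_vars M (\<lambda>u X. X u) I"
    by (rule indep_vars_subset) fact
  then have indep: "indep_vars (\<lambda>_. borel) (\<lambda>u X. w u * X u) I"
    by (rule indep_vars_compose2) measurable
  have normal: "distributed (PiM {..<N} M) lborel (\<lambda>X. w u * X u)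
      (normal_density (w u * m u) (\<bar>w u\<bar> * \<sigma>))" if "u \<in> I" for u
  proof -
    have "distr (PiM {..<N} M) lborel (\<lambda>X. X u) = distr (PiM {..<N} M) (M u) (\<lambda>X. X u)"
      by (intro distr_cong) (auto simp: M_def)
    also have "\<dots> = M u"
      using that by (intro distr_PiM_component ps) (auto simp: I_def)
    finally have "distributed (PiM {..<N} M) lborel (\<lambda>X. X u) (normal_density (m u) \<sigma>)"
      using that by (auto simp: distributed_def M_def I_def)
    from normal_density_affine[OF this assms(1), of "w u" 0] show ?thesis
      using that by (simp add: I_def)
  qed
  have "distributed (PiM {..<N} M) lborel (\<lambda>X. \<Sum>u\<in>I. w u * X u)
      (normal_density (\<Sum>u\<in>I. w u * m u) (sqrt (\<Sum>u\<in>I. (\<bar>w u\<bar> * \<sigma>)\<^sup>2)))"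
    using assms(1) by (intro sum_indep_normal I indep normal) (auto simp: I_def)
  moreover have pos: "0 < (\<Sum>u\<in>I. (\<bar>w u\<bar> * \<sigma>)\<^sup>2)"
    using I assms(1) by (intro sum_pos) (auto simp: I_def)
  ultimately have "variance (\<lambda>X. \<Sum>u\<in>I. w u * X u) = (sqrt (\<Sum>u\<in>I. (\<bar>w u\<bar> * \<sigma>)\<^sup>2))\<^sup>2"
    by (intro normal_distributed_variance) auto
  also have "\<dots> = (\<Sum>u\<in>I. (\<bar>w u\<bar> * \<sigma>)\<^sup>2)"
    using pos by simp
  also have "\<dots> = \<sigma>\<^sup>2 * (\<Sum>u\<in>I. w u * w u)"
    by (simp add: power_mult_distrib sum_distrib_left mult.commute flip: power2_eq_square)
  also have "\<dots> = \<sigma>\<^sup>2 * (\<Sum>u<N. (w u)\<^sup>2)"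
    unfolding sum_I by (simp add: power2_eq_square)
  finally show ?thesis
    unfolding F sum_I .
qed

text \<open>The slice over \<open>A\<close> has mass \<open>pmf G A\<close>, and \<open>B\<close>
  meets it in the section of \<open>B\<close> at \<open>A\<close>. The product measure makes this
  mass, positive on the support, cancel.\<close>

lemma uniform_measure_pair_pmf:
  assumes "prob_space F" "A \<in> set_pmf G"
  shows "uniform_measure (measure_pmf G \<Otimes>\<^sub>M F) {\<omega> \<in> space (measure_pmf G \<Otimes>\<^sub>M F). fst \<omega> = A}
    = distr F (measure_pmf G \<Otimes>\<^sub>M F) (Pair A)"
    (is "uniform_measure ?M ?S = ?D")
proof (rule measure_eqI)
  interpret F: prob_space F by fact
  have S: "?S = {A} \<times> space F"
    by (auto simp: space_pair_measure)
  have S_sets: "?S \<in> sets ?M"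
    unfolding S by (intro pair_measureI) auto
  have S_measure: "emeasure ?M ?S = pmf G A"
    unfolding S by (subst F.emeasure_pair_measure_Times) (auto simp: F.emeasure_space_1 emeasure_pmf_single)
  fix B
  assume "B \<in> sets (uniform_measure ?M ?S)"
  then have B: "B \<in> sets ?M"
    by simp
  have "?S \<inter> B = {A} \<times> (Pair A -` B)"
    using sets.sets_into_space[OF B] by (auto simp: space_pair_measure)
  then have "emeasure ?M (?S \<inter> B) = pmf G A * emeasure F (Pair A -` B)"
    using sets_Pair1[OF B, of A]
    by (simp add: F.emeasure_pair_measure_Times emeasure_pmf_single)
  moreover have "0 < pmf G A"
    using assms(2) by (simp add: pmf_positive)
  ultimately have "emeasure (uniform_measure ?M ?S) B = emeasure F (Pair A -` B)"
    using S_sets B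
    by (simp add: S_measure mult.commute[of "ennreal _"] ennreal_mult_divide_eq)
  also have "\<dots> = emeasure ?D B"
    using B sets.sets_into_space[OF B]
    by (subst emeasure_distr) (auto intro!: arg_cong[where f = "emeasure F"] simp: space_pair_measure)
  finally show "emeasure (uniform_measure ?M ?S) B = emeasure ?D B" .
qed simp

text \<open>Joint measurability in graph and features lets the variance be transferred along
  \<open>Pair A\<close>. Every function is measurable on the discrete graph factor.\<close>

lemma appnp_measurable:
  assumes "v < N" "\<And>u. u < N \<Longrightarrow> sets (M u) = sets borel"
  shows "(\<lambda>(A, X). appnp N \<alpha> A X n v) \<in> borel_measurable (measure_pmf G \<Otimes>\<^sub>M PiM {..<N} M)"
  using assms(1)
proof (induction n arbitrary: v)
  case 0
  have "(\<lambda>X. X v) \<in> measurable (PiM {..<N} M) (M v)"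
    using 0 by (intro measurable_component_singleton) auto
  then have "(\<lambda>X. X v) \<in> borel_measurable (PiM {..<N} M)"
    using measurable_cong_sets[OF refl assms(2)[OF 0]] by blast
  from measurable_compose[OF measurable_snd this]
  show ?case by (simp add: case_prod_beta)
next
  case (Suc n)
  have adj: "(\<lambda>\<omega>. fst \<omega> u u') \<in> borel_measurable (measure_pmf G \<Otimes>\<^sub>M PiM {..<N} M)" for u u'
    by (rule measurable_compose[OF measurable_fst]) simp
  have "(\<lambda>X. X v) \<in> measurable (PiM {..<N} M) (M v)"
    using Suc by (intro measurable_component_singleton) auto
  then have "(\<lambda>X. X v) \<in> borel_measurable (PiM {..<N} M)"
    using measurable_cong_sets[OF refl assms(2)[OF Suc.prems]] by blast
  from measurable_compose[OF measurable_snd this]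
  have feature: "(\<lambda>\<omega>. snd \<omega> v) \<in> borel_measurable (measure_pmf G \<Otimes>\<^sub>M PiM {..<N} M)" .
  show ?case
    using Suc.IH unfolding case_prod_beta appnp.simps node_degree_def
    by (intro borel_measurable_add borel_measurable_times borel_measurable_sum
          borel_measurable_divide borel_measurable_const adj feature) auto
qed

lemma appnp_variance_eq:
  assumes "0 < \<sigma>" "v < N" "u0 < N" "appnp_weight N \<alpha> A n v u0 \<noteq> 0"
    and "A \<in> set_pmf (csbm_graph N C p q)"
  shows "appnp_variance N C p q \<mu>1 \<mu>2 \<sigma> \<alpha> A n v = \<sigma>\<^sup>2 * (\<Sum>u<N. (appnp_weight N \<alpha> A n v u)\<^sup>2)"
proof -
  let ?F = "csbm_features N C \<mu>1 \<mu>2 \<sigma>" and ?f = "\<lambda>(A, X). appnp N \<alpha> A X n v"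
  let ?M = "measure_pmf (csbm_graph N C p q) \<Otimes>\<^sub>M ?F"
  have F: "prob_space ?F"
    unfolding csbm_features_def using assms(1) by (intro prob_space_PiM prob_space_normal_density)
  have f: "?f \<in> borel_measurable ?M"
    unfolding csbm_features_def using assms(2) by (rule appnp_measurable) simp
  \<comment> \<open>On the image of \<open>Pair A\<close> the graph is fixed and only the features
    are random.\<close>
  have "prob_space.variance (distr ?F ?M (Pair A)) ?f
      = prob_space.variance ?F (\<lambda>X. appnp N \<alpha> A X n v)"
    using f by (simp add: integral_distr)
  then show ?thesis
    unfolding appnp_variance_def variance_given_def csbm_def
    using variance_csbm_features[OF assms(1,3), of "appnp_weight N \<alpha> A n v"] assms(4)
    by (simp add: uniform_measure_pair_pmf[OF F assms(5)] appnp_eq_weighted_sum[OF assms(2)])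
qed

section \<open>Concentration of the degrees\<close>

lemma csbm_graph_bounds:
  assumes "A \<in> set_pmf (csbm_graph N C p q)"
  shows "0 \<le> A v u" "A v u \<le> 1"
  using assms by (auto simp: csbm_graph_def)

text \<open>Evenness makes the two classes equal in size. A node \<open>v < N\<close> counts itself,
  matching its possible self-loop, so no 1 is subtracted.\<close>

lemma card_same_class:
  assumes "even N" "C \<subseteq> {..<N}" "card C = N div 2"
  shows "real (card {u. u < N \<and> (v \<in> C \<longleftrightarrow> u \<in> C)}) = real N / 2"
proof (cases "v \<in> C")
  case True
  then have "{u. u < N \<and> (v \<in> C \<longleftrightarrow> u \<in> C)} = C"
    using assms by auto
  then show ?thesis
    using assms by auto
next
  case False
  then have "{u. u < N \<and> (v \<in> C \<longleftrightarrow> u \<in> C)} = {..<N} - C"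
    by auto
  moreover have "card ({..<N} - C) = N - N div 2"
    using assms by (simp add: card_Diff_subset finite_subset)
  ultimately show ?thesis
    using assms by auto
qed

text \<open>Chernoff's method with exponent \<open>-1\<close>, applied only to the edges inside the class of \<open>v\<close>.\<close>

lemma csbm_degree_tail:
  assumes C: "even N" "C \<subseteq> {..<N}" "card C = N div 2" and "v < N"
    and p: "0 \<le> p" "p \<le> 1"
  shows "measure_pmf.prob (csbm_graph N C p q) {A. node_degree N A v < real N * p / 8}
    \<le> exp (- (real N * p / 8))"
proof -
  define I where "I = {(u, v). u \<le> v \<and> v < N}"
  define B where "B = Pi_pmf I False (\<lambda>(u, v). bernoulli_pmf (csbm_edge_prob C p q u v))"
  define S where "S = {u. u < N \<and> (v \<in> C \<longleftrightarrow> u \<in> C)}"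
  \<comment> \<open>The index of the edge between \<open>v\<close> and \<open>u\<close> in the upper
    triangle; injectivity makes the edges to \<open>S\<close> distinct independent
    coordinates.\<close>
  define e where "e u = (min v u, max v u)" for u
  \<comment> \<open>All other coordinates get the factor 1, so \<open>exp (- T b)\<close> is a
    product over \<open>I\<close> and its expectation factorises.\<close>
  define f where "f x y = (if x \<in> e ` S then exp (- of_bool y) else 1 :: real)" for x y
  define T where "T b = (\<Sum>u\<in>S. of_bool (b (e u)) :: real)" for b :: "nat \<times> nat \<Rightarrow> bool"
  define t where "t = real N * p / 8"
  have fin: "finite I" "finite S"
    by (rule finite_subset[of _ "{..<N} \<times> {..<N}"]) (auto simp: I_def S_def)
  have eI: "e ` S \<subseteq> I"
    using \<open>v < N\<close> by (auto simp: e_def S_def I_def)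
  have inj: "inj_on e S"
    by (auto simp: inj_on_def e_def min_def max_def split: if_splits)
  have prod_f: "(\<Prod>x\<in>I. f x (b x)) = exp (- T b)" for b
  proof -
    have "(\<Prod>x\<in>I. f x (b x)) = (\<Prod>x\<in>e ` S. exp (- of_bool (b x)))"
      using fin eI by (intro prod.mono_neutral_cong_right) (auto simp: f_def)
    also have "\<dots> = (\<Prod>u\<in>S. exp (- of_bool (b (e u))))"
      using inj by (simp add: prod.reindex)
    also have "\<dots> = exp (- T b)"
      using fin(2) unfolding T_def sum_negf[symmetric] by (rule exp_sum[symmetric])
    finally show ?thesis .
  qed
  have f_integrable: "integrable (measure_pmf (bernoulli_pmf r)) (f x)" for r x
    by (rule integrable_measure_pmf_finite) (rule finite_subset[of _ UNIV], auto)
  have "integrable (measure_pmf B) (\<lambda>b. \<Prod>x\<in>I. f x (b x))"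
    unfolding B_def using fin f_integrable by (intro integrable_prod_Pi_pmf) auto
  then have T_integrable: "integrable (measure_pmf B) (\<lambda>b. exp (- T b))"
    by (simp only: prod_f)
  have factor: "measure_pmf.expectation
      (case x of (u, v) \<Rightarrow> bernoulli_pmf (csbm_edge_prob C p q u v)) (f x)
      = (if x \<in> e ` S then 1 - p * (1 - exp (- 1)) else 1)" for x
  proof (cases "x \<in> e ` S")
    case True
    then obtain u where u: "u \<in> S" "x = e u"
      by auto
    then have "csbm_edge_prob C p q (fst x) (snd x) = p"
      by (auto simp: S_def e_def csbm_edge_prob_def min_def max_def)
    then show ?thesis
      using True p by (simp add: case_prod_beta f_def algebra_simps)
  next
    case False
    then show ?thesis
      by (simp add: f_def[abs_def])
  qed
  have "measure_pmf.expectation B (\<lambda>b. exp (- T b))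
      = measure_pmf.expectation B (\<lambda>b. \<Prod>x\<in>I. f x (b x))"
    by (simp only: prod_f)
  also have "\<dots> = (\<Prod>x\<in>I. if x \<in> e ` S then 1 - p * (1 - exp (- 1)) else 1)"
    unfolding B_def factor[symmetric] using fin f_integrable
    by (intro expectation_prod_Pi_pmf) (auto, simp add: f_def)
  also have "\<dots> = (\<Prod>x\<in>e ` S. 1 - p * (1 - exp (- 1)))"
    using fin eI by (intro prod.mono_neutral_cong_right) auto
  also have "\<dots> = (1 - p * (1 - exp (- 1))) ^ card S"
    using inj by (simp add: card_image)
  \<comment> \<open>From \<open>exp 1 \<ge> 2\<close>:
    \<open>1 - p (1 - exp (- 1)) \<le> 1 - p / 2 \<le> exp (- p / 2)\<close>.\<close>
  also have "\<dots> \<le> exp (- p / 2) ^ card S"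
  proof (rule power_mono)
    have "2 \<le> exp (1::real)"
      using exp_ge_add_one_self[of "1::real"] by simp
    then have "exp (- 1) \<le> (1 / 2 :: real)"
      by (simp add: exp_minus field_simps)
    then have "p * (1 / 2) \<le> p * (1 - exp (- 1))"
      using p by (intro mult_left_mono) auto
    then show "1 - p * (1 - exp (- 1)) \<le> exp (- p / 2)"
      using exp_ge_add_one_self[of "- p / 2"] by linarith
    have "p * (1 - exp (- 1)) \<le> 1 * 1"
      using p by (intro mult_mono) auto
    then show "0 \<le> 1 - p * (1 - exp (- 1))"
      by simp
  qed
  \<comment> \<open>With \<open>card S = N / 2\<close> the exponent is \<open>- N p / 4\<close>,
    twice \<open>- t\<close>.\<close>
  also have "\<dots> = exp (- 2 * t)"
    using card_same_class[OF C, of v]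
    by (simp add: exp_of_nat_mult[symmetric] S_def t_def)
  finally have mgf: "measure_pmf.expectation B (\<lambda>b. exp (- T b)) \<le> exp (- 2 * t)" .
  have "measure_pmf.prob (csbm_graph N C p q) {A. node_degree N A v < t}
      \<le> measure_pmf.prob B {b. T b < t}"
  proof -
    \<comment> \<open>Dropping the nonnegative entries of the other class only lowers the
      degree.\<close>
    have "T b \<le> node_degree N (\<lambda>u v. if u < N \<and> v < N then of_bool (b (min u v, max u v)) else 0) v"
      for b
      unfolding T_def node_degree_def using \<open>v < N\<close>
      by (intro order.trans[OF eq_refl sum_mono2[of "{..<N}" S]] sum.cong) (auto simp: S_def e_def)
    then show ?thesis
      unfolding csbm_graph_def I_def[symmetric] B_def[symmetric] measure_map_pmf
      by (intro measure_pmf.finite_measure_mono) (auto intro: le_less_trans)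
  qed
  also have "\<dots> = measure_pmf.expectation B (indicator {b. T b < t})"
    by simp
  \<comment> \<open>Markov's inequality: \<open>exp (t - T b)\<close> exceeds 1 where
    \<open>T b < t\<close>.\<close>
  also have "\<dots> \<le> measure_pmf.expectation B (\<lambda>b. exp t * exp (- T b))"
  proof (rule integral_mono)
    show "integrable (measure_pmf B) (indicator {b. T b < t} :: _ \<Rightarrow> real)"
      by (rule measure_pmf.integrable_const_bound[where B = 1]) (auto simp: indicator_def)
    show "integrable (measure_pmf B) (\<lambda>b. exp t * exp (- T b))"
      using T_integrable by simp
  qed (simp add: indicator_def exp_add[symmetric])
  also have "\<dots> \<le> exp t * exp (- 2 * t)"
    using mgf by simp
  also have "\<dots> = exp (- t)"
    by (simp add: exp_add[symmetric])
  finally show ?thesis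
    by (simp add: t_def)
qed

text \<open>Union bound: the constant 16 makes each of the \<open>N\<close> failure probabilities at
  most \<open>1 / N\<^sup>2\<close>.\<close>

lemma csbm_min_degree:
  assumes C: "even N" "C \<subseteq> {..<N}" "card C = N div 2" and "0 < N"
    and p: "0 \<le> p" "p \<le> 1" and large: "16 * ln (real N) \<le> real N * p"
  shows "1 - 1 / real N
    \<le> measure_pmf.prob (csbm_graph N C p q) {A. \<forall>v<N. real N * p / 8 \<le> node_degree N A v}"
proof -
  let ?G = "csbm_graph N C p q" and ?E = "\<lambda>v. {A. node_degree N A v < real N * p / 8}"
  have "exp (- (real N * p / 8)) \<le> exp (- 2 * ln (real N))"
    using large by simp
  also have "\<dots> = 1 / (real N)\<^sup>2"
    using \<open>0 < N\<close> by (simp add: exp_minus exp_double field_simps)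
  finally have tail: "exp (- (real N * p / 8)) \<le> 1 / (real N)\<^sup>2" .
  have "measure_pmf.prob ?G (\<Union>v<N. ?E v) \<le> (\<Sum>v<N. measure_pmf.prob ?G (?E v))"
    by (intro measure_pmf.finite_measure_subadditive_finite) auto
  also have "\<dots> \<le> (\<Sum>v<N. 1 / (real N)\<^sup>2)"
    using csbm_degree_tail[OF C _ p] tail by (intro sum_mono) (meson lessThan_iff order.trans)
  also have "\<dots> = 1 / real N"
    using \<open>0 < N\<close> by (simp add: power2_eq_square)
  finally have "measure_pmf.prob ?G (\<Union>v<N. ?E v) \<le> 1 / real N" .
  moreover have "{A. \<forall>v<N. real N * p / 8 \<le> node_degree N A v} = UNIV - (\<Union>v<N. ?E v)"
    by (auto simp: not_less)
  ultimately show ?thesis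
    using measure_pmf.prob_compl[of "\<Union>v<N. ?E v" ?G] by simp
qed

section \<open>Comparison with the claimed bounds\<close>

text \<open>The single term \<open>9 / min a 2\<close> is at least \<open>9 / 2\<close>, so the cap
  1 applies.\<close>

lemma var_upper_0:
  assumes "0 < degree_ratio N p"
  shows "var_upper N p q \<sigma> 0 = \<sigma>\<^sup>2"
proof -
  have "min (degree_ratio N p) 2 \<le> 2" "0 < min (degree_ratio N p) 2"
    using assms by auto
  then have "1 \<le> 9 / min (degree_ratio N p) 2"
    by (subst le_divide_eq_1_pos) auto
  then show ?thesis
    by (simp add: var_upper_def)
qed

lemma var_upper_nonneg:
  assumes "0 < degree_ratio N p" "0 \<le> p" "0 \<le> q"
  shows "0 \<le> var_upper N p q \<sigma> n"
  unfolding var_upper_def using assms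
  by (intro mult_nonneg_nonneg min.boundedI sum_nonneg) auto

text \<open>Only \<open>k = 0\<close> occurs, with prefactor \<open>9 / 2\<close> as
  \<open>a \<ge> 2\<close>, and \<open>q \<le> p\<close> gives
  \<open>2 / (N (p + q)) \<ge> 1 / (N p)\<close>. The assumption \<open>1 \<le> N p\<close> handles
  the cap.\<close>

lemma var_upper_1_ge:
  assumes "2 \<le> degree_ratio N p" "1 \<le> real N * p" "0 < q" "q \<le> p"
  shows "\<sigma>\<^sup>2 / (real N * p) \<le> var_upper N p q \<sigma> 1"
proof -
  have pos: "0 < real N" "0 < p"
    using assms by (auto intro: gr0I)
  have "real N * (p + q) \<le> 2 * (real N * p)"
    using pos assms by simp
  then have "1 / (real N * p) \<le> 2 / (real N * (p + q))"
    using pos assms by (simp add: pos_divide_le_eq pos_le_divide_eq)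
  then have inverse_le: "(1 / (real N * p))\<^sup>2 \<le> (2 / (real N * (p + q)))\<^sup>2"
    using pos by (intro power_mono) auto
  have "1 / (real N * p) = (real N * p) * (1 / (real N * p))\<^sup>2"
    using pos by (simp add: power2_eq_square)
  also have "\<dots> \<le> (real N * p) * (2 / (real N * (p + q)))\<^sup>2"
    using pos inverse_le by (intro mult_left_mono) auto
  also have "\<dots> \<le> 9 / 2 * ((real N * p) * (2 / (real N * (p + q)))\<^sup>2)"
    using pos by simp
  finally have "1 / (real N * p) \<le> min (9 / 2 * (real N * p * (2 / (real N * (p + q)))\<^sup>2)) 1"
    using assms(2) by simp
  from mult_right_mono[OF this, of "\<sigma>\<^sup>2"]
  have "\<sigma>\<^sup>2 / (real N * p)
      \<le> min (9 / 2 * (real N * p * (2 / (real N * (p + q)))\<^sup>2)) 1 * \<sigma>\<^sup>2"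
    by simp
  moreover have "min (degree_ratio N p) 2 = 2"
    using assms(1) by simp
  ultimately show ?thesis
    by (simp add: var_upper_def mult.assoc)
qed

text \<open>The terms \<open>k = 0\<close> and \<open>k = 1\<close> give at least \<sigma> and
  \<open>(1 - \<alpha>) \<sigma> / sqrt (N p)\<close>. Their cross term dominates
  \<open>8 \<sigma>\<^sup>2 / (N p)\<close> once
  \<open>sqrt (N p) \<ge> 4 / (\<alpha>\<^sup>2 (1 - \<alpha>))\<close>, which squared is the last
  assumption.\<close>

lemma upper_bound_ge:
  assumes "0 < \<sigma>" "0 < \<alpha>" "\<alpha> < 1" "0 < n" "0 < q" "q \<le> p" "2 \<le> degree_ratio N p"
    and large: "1 \<le> real N * p" "16 / (\<alpha>\<^sup>2 * (1 - \<alpha>))\<^sup>2 \<le> real N * p"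
  shows "\<sigma>\<^sup>2 * (\<alpha>\<^sup>2 + 1 / (real N * p / 8))
    \<le> (\<alpha> * (\<Sum>k<n. (1 - \<alpha>) ^ k * sqrt (var_upper N p q \<sigma> k))
        + (1 - \<alpha>) ^ n * sqrt (var_upper N p q \<sigma> n))\<^sup>2"
proof -
  define x where "x = real N * p"
  define g where "g k = (1 - \<alpha>) ^ k * sqrt (var_upper N p q \<sigma> k)" for k
  define r where "r = sqrt x"
  have x: "0 < x" "x = r * r" and r: "0 < r"
    using large by (auto simp: x_def r_def)
  have g_nonneg: "0 \<le> g k" for k
    using assms var_upper_nonneg[of N p q \<sigma> k] by (simp add: g_def)
  have g0: "g 0 = \<sigma>"
    using assms by (simp add: g_def var_upper_0)
  have "sqrt (\<sigma>\<^sup>2 / x) \<le> sqrt (var_upper N p q \<sigma> 1)"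
    using var_upper_1_ge[of N p q \<sigma>] assms by (simp add: x_def)
  then have "\<sigma> / r \<le> sqrt (var_upper N p q \<sigma> 1)"
    using assms by (simp add: real_sqrt_divide r_def)
  then have g1: "(1 - \<alpha>) * (\<sigma> / r) \<le> g 1"
    unfolding g_def power_one_right by (rule mult_left_mono) (use assms(3) in simp)
  have "\<alpha> * (\<sigma> + g 1) \<le> \<alpha> * (\<Sum>k<n. g k) + g n"
  \<comment> \<open>For \<open>n = 1\<close> the sum stops at \<open>k = 0\<close> and
    \<open>g 1\<close> is the final summand, with coefficient 1 instead of \<alpha>; for larger
    \<open>n\<close> both terms lie in the sum.\<close>
  proof (cases "n = 1")
    case True
    have "\<alpha> * g 1 \<le> 1 * g 1"
      using assms g_nonneg by (intro mult_right_mono) auto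
    then show ?thesis
      using True g0 by (simp add: distrib_left)
  next
    case False
    then have "(\<Sum>k\<in>{0, 1}. g k) \<le> (\<Sum>k<n. g k)"
      using assms g_nonneg by (intro sum_mono2) auto
    then have "\<sigma> + g 1 \<le> (\<Sum>k<n. g k)"
      using g0 by simp
    then have "\<alpha> * (\<sigma> + g 1) \<le> \<alpha> * (\<Sum>k<n. g k)"
      by (rule mult_left_mono) (use assms(2) in simp)
    then show ?thesis
      using g_nonneg[of n] by linarith
  qed
  moreover have "\<alpha> * (\<sigma> + (1 - \<alpha>) * (\<sigma> / r)) \<le> \<alpha> * (\<sigma> + g 1)"
    using g1 assms by simp
  ultimately have "\<alpha> * (\<sigma> + (1 - \<alpha>) * (\<sigma> / r)) \<le> \<alpha> * (\<Sum>k<n. g k) + g n"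
    by linarith
  then have "(\<alpha> * (\<sigma> + (1 - \<alpha>) * (\<sigma> / r)))\<^sup>2 \<le> (\<alpha> * (\<Sum>k<n. g k) + g n)\<^sup>2"
    using assms r by (intro power_mono) auto
  moreover have "\<sigma>\<^sup>2 * (\<alpha>\<^sup>2 + 1 / (x / 8)) \<le> (\<alpha> * (\<sigma> + (1 - \<alpha>) * (\<sigma> / r)))\<^sup>2"
  proof -
    have "sqrt ((4 / (\<alpha>\<^sup>2 * (1 - \<alpha>)))\<^sup>2) \<le> r"
      unfolding r_def x_def using large(2) by (intro real_sqrt_le_mono) (simp add: power_divide)
    then have "4 / (\<alpha>\<^sup>2 * (1 - \<alpha>)) \<le> r"
      using assms by simp
    then have "4 \<le> \<alpha>\<^sup>2 * (1 - \<alpha>) * r"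
      using assms by (simp add: field_simps)
    then have "8 \<le> 2 * (\<alpha>\<^sup>2 * (1 - \<alpha>) * r)"
      by linarith
    then have "8 / x \<le> 2 * (\<alpha>\<^sup>2 * (1 - \<alpha>) * r) / x"
      by (rule divide_right_mono) (use x(1) in simp)
    also have "\<dots> = 2 * \<alpha>\<^sup>2 * ((1 - \<alpha>) / r)"
      using r by (simp add: x(2))
    finally have cross_term: "8 / x \<le> 2 * \<alpha>\<^sup>2 * ((1 - \<alpha>) / r)" .
    have square: "(\<alpha> * (1 + y))\<^sup>2 = \<alpha>\<^sup>2 + 2 * \<alpha>\<^sup>2 * y + (\<alpha> * y)\<^sup>2" for y
      by (simp add: power2_eq_square algebra_simps)
    have "\<alpha>\<^sup>2 + 8 / x \<le> (\<alpha> * (1 + (1 - \<alpha>) / r))\<^sup>2"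
      unfolding square using cross_term zero_le_power2[of "\<alpha> * ((1 - \<alpha>) / r)"] by linarith
    then have "\<sigma>\<^sup>2 * (\<alpha>\<^sup>2 + 8 / x) \<le> \<sigma>\<^sup>2 * (\<alpha> * (1 + (1 - \<alpha>) / r))\<^sup>2"
      by (intro mult_left_mono) auto
    also have "\<dots> = (\<sigma> * (\<alpha> * (1 + (1 - \<alpha>) / r)))\<^sup>2"
      by (rule power_mult_distrib[symmetric])
    also have "\<sigma> * (\<alpha> * (1 + (1 - \<alpha>) / r)) = \<alpha> * (\<sigma> + (1 - \<alpha>) * (\<sigma> / r))"
      by (simp add: distrib_left mult.left_commute mult.commute)
    finally show ?thesis by simp
  qed
  ultimately show ?thesis
    unfolding g_def x_def by linarith
qed

text \<open>The threshold forces \<open>1 / x \<le> \<alpha>\<^sup>2\<close>, so the bracket is at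
  most \<open>2 \<alpha>\<^sup>2\<close>, and the factor \<open>m / 10 \<le> 1 / 5\<close> absorbs
  the 2.\<close>

lemma lower_bound_le:
  fixes \<alpha> x m :: real
  assumes "0 < \<alpha>" "\<alpha> < 1" "0 < n" "0 \<le> m" "m \<le> 2"
    and "1 \<le> x" "16 / (\<alpha>\<^sup>2 * (1 - \<alpha>))\<^sup>2 \<le> x"
  shows "m / 10 * (\<alpha>\<^sup>2 + (1 - \<alpha>) ^ (2 * n) / x ^ n) \<le> \<alpha>\<^sup>2"
proof -
  have "\<alpha> * (\<alpha> * (1 - \<alpha>)) \<le> \<alpha> * 1"
    using assms by (intro mult_left_mono mult_le_one) auto
  then have "(\<alpha>\<^sup>2 * (1 - \<alpha>))\<^sup>2 \<le> \<alpha>\<^sup>2"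
    using assms by (intro power_mono) (auto simp: power2_eq_square mult.assoc)
  then have "x * (\<alpha>\<^sup>2 * (1 - \<alpha>))\<^sup>2 \<le> x * \<alpha>\<^sup>2"
    using assms by (intro mult_left_mono) auto
  moreover have "16 \<le> x * (\<alpha>\<^sup>2 * (1 - \<alpha>))\<^sup>2"
    using assms by (simp add: divide_le_eq)
  ultimately have "1 \<le> x * \<alpha>\<^sup>2"
    by linarith
  then have "1 / x \<le> \<alpha>\<^sup>2"
    using assms by (simp add: pos_divide_le_eq mult.commute)
  moreover have "(1 - \<alpha>) ^ (2 * n) / x ^ n \<le> 1 / x"
    using assms by (intro frac_le power_le_one self_le_power) auto
  ultimately have "\<alpha>\<^sup>2 + (1 - \<alpha>) ^ (2 * n) / x ^ n \<le> 2 * \<alpha>\<^sup>2"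
    by simp
  then have "m / 10 * (\<alpha>\<^sup>2 + (1 - \<alpha>) ^ (2 * n) / x ^ n) \<le> 2 / 10 * (2 * \<alpha>\<^sup>2)"
    using assms by (intro mult_mono) auto
  then show ?thesis
    using zero_le_power2[of \<alpha>] by linarith
qed

section \<open>Both variance bounds with probability \<open>1 - O(1 / N)\<close>\<close>

theorem proposition5:
  fixes \<sigma> \<alpha> \<mu>1 \<mu>2 :: real
    and p q :: "nat \<Rightarrow> real"
    and C1 :: "nat \<Rightarrow> nat set"
  assumes "\<sigma> > 0" and "0 < \<alpha>" and "\<alpha> < 1" and "\<mu>1 < \<mu>2"
    and "\<And>N. even N \<Longrightarrow> N \<ge> 2 \<Longrightarrow> C1 N \<subseteq> {..<N} \<and> card (C1 N) = N div 2"
    and "\<And>N. even N \<Longrightarrow> N \<ge> 2 \<Longrightarrow> 0 < q N \<and> q N < p N \<and> p N \<le> 1"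
    and "p \<in> \<omega>[even_at_top](\<lambda>N. ln (real N) / real N)"
    and "q \<in> \<omega>[even_at_top](\<lambda>N. ln (real N) / real N)"
  shows "\<exists>K::real. \<forall>N::nat. even N \<and> N \<ge> 2 \<longrightarrow>
    measure_pmf.prob (csbm_graph N (C1 N) (p N) (q N))
      {A. (\<forall>v<N. node_degree N A v > 0) \<and>
          (\<forall>n\<in>{1..N}. \<forall>v<N.
            max (min (degree_ratio N (p N)) 2 / 10
                   * (\<alpha>\<^sup>2 + (1 - \<alpha>) ^ (2 * n) / (real N * p N) ^ n))
                (1 / real N) * \<sigma>\<^sup>2
              \<le> appnp_variance N (C1 N) (p N) (q N) \<mu>1 \<mu>2 \<sigma> \<alpha> A n v \<and>
            appnp_variance N (C1 N) (p N) (q N) \<mu>1 \<mu>2 \<sigma> \<alpha> A n v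
              \<le> min ((\<alpha> * (\<Sum>k<n. (1 - \<alpha>) ^ k * sqrt (var_upper N (p N) (q N) \<sigma> k))
                       + (1 - \<alpha>) ^ n * sqrt (var_upper N (p N) (q N) \<sigma> n))\<^sup>2)
                    (\<sigma>\<^sup>2))}
      \<ge> 1 - K / real N"
proof -
  \<comment> \<open>The first summand serves the degree tail, the second is the threshold of both
    comparisons; one multiple of \<open>ln N / N\<close> yields both once
    \<open>ln N \<ge> 1\<close>.\<close>
  define c where "c = 16 + 16 / (\<alpha>\<^sup>2 * (1 - \<alpha>))\<^sup>2"
  have c: "16 \<le> c" "16 / (\<alpha>\<^sup>2 * (1 - \<alpha>))\<^sup>2 \<le> c"
    by (auto simp: c_def)
  have "\<forall>\<^sub>F N in even_at_top. c * norm (ln (real N) / real N) \<le> norm (p N)"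
    by (rule smallomegaD) fact
  then have "\<forall>\<^sub>F N in at_top. even N \<longrightarrow> c * norm (ln (real N) / real N) \<le> norm (p N)"
    by (simp add: eventually_inf_principal)
  then obtain N0 where N0: "c * norm (ln (real N) / real N) \<le> norm (p N)"
    if "N0 \<le> N" "even N" for N
    by (auto simp: eventually_sequentially)
  \<comment> \<open>For \<open>N < K\<close> the claimed probability is at most 0. Otherwise
    \<open>N \<ge> 3\<close> gives \<open>ln N \<ge> 1\<close>, and \<open>K \<ge> 1\<close> absorbs
    the failure probability \<open>1 / N\<close>.\<close>
  define K where "K = real (max N0 3)"
  show ?thesis
  proof (intro exI[of _ K] allI impI)
    fix N :: nat
    assume N: "even N \<and> N \<ge> 2"
    let ?G = "csbm_graph N (C1 N) (p N) (q N)"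
    let ?V = "appnp_variance N (C1 N) (p N) (q N) \<mu>1 \<mu>2 \<sigma> \<alpha>"
    let ?lower = "\<lambda>n. max (min (degree_ratio N (p N)) 2 / 10
                   * (\<alpha>\<^sup>2 + (1 - \<alpha>) ^ (2 * n) / (real N * p N) ^ n)) (1 / real N) * \<sigma>\<^sup>2"
    let ?upper = "\<lambda>n. min ((\<alpha> * (\<Sum>k<n. (1 - \<alpha>) ^ k * sqrt (var_upper N (p N) (q N) \<sigma> k))
                       + (1 - \<alpha>) ^ n * sqrt (var_upper N (p N) (q N) \<sigma> n))\<^sup>2) (\<sigma>\<^sup>2)"
    let ?E = "{A. (\<forall>v<N. node_degree N A v > 0) \<and>
      (\<forall>n\<in>{1..N}. \<forall>v<N. ?lower n \<le> ?V A n v \<and> ?V A n v \<le> ?upper n)}"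
    note C = assms(5)[of N] and pq = assms(6)[of N]
    show "1 - K / real N \<le> measure_pmf.prob ?G ?E"
    proof (cases "real N < K")
      case True
      then have "1 - K / real N \<le> 0"
        using N by (simp add: field_simps)
      then show ?thesis
        by (rule order.trans) simp
    next
      case False
      then have "N0 \<le> N" "3 \<le> N"
        by (auto simp: K_def)
      have "exp 1 \<le> real N"
        using exp_le \<open>3 \<le> N\<close> by linarith
      then have ln_ge_1: "1 \<le> ln (real N)"
        using \<open>3 \<le> N\<close> by (subst ln_ge_iff) auto
      have "c * (ln (real N) / real N) \<le> p N"
        using N0[of N] \<open>N0 \<le> N\<close> N pq ln_ge_1 by simp
      then have c_ln: "c * ln (real N) \<le> real N * p N"
        using N by (simp add: field_simps)
      have "16 * ln (real N) \<le> c * ln (real N)" "c * 1 \<le> c * ln (real N)"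
        using c ln_ge_1 by (auto intro!: mult_left_mono mult_right_mono)
      with c_ln have large: "16 * ln (real N) \<le> real N * p N" "c \<le> real N * p N"
        by auto
      have ratio: "2 \<le> degree_ratio N (p N)"
        using large(1) ln_ge_1 by (simp add: degree_ratio_def field_simps)
      have "A \<in> ?E" if A: "A \<in> set_pmf ?G"
        and degree: "\<forall>v<N. real N * p N / 8 \<le> node_degree N A v" for A
      proof -
        interpret min_degree_graph N A \<alpha> "real N * p N / 8"
          using csbm_graph_bounds[OF A] degree assms(2,3) c large by unfold_locales auto
        \<comment> \<open>One degree event serves every \<open>n \<ge> 1\<close> and every node, so
          no union over \<open>n\<close> arises.\<close>
        have "?lower n \<le> ?V A n v \<and> ?V A n v \<le> ?upper n" if n: "0 < n" and v: "v < N" for n v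
        proof -
          \<comment> \<open>A row of sum 1 has a nonzero entry, as the variance formula
            requires.\<close>
          have "\<exists>u<N. W n v u \<noteq> 0"
            using sum_W[OF v, of n] by (metis lessThan_iff sum.neutral zero_neq_one)
          then have V: "?V A n v = \<sigma>\<^sup>2 * (\<Sum>u<N. (W n v u)\<^sup>2)"
            using appnp_variance_eq[OF assms(1) v _ _ A] by blast
          have "min (degree_ratio N (p N)) 2 / 10
              * (\<alpha>\<^sup>2 + (1 - \<alpha>) ^ (2 * n) / (real N * p N) ^ n) \<le> \<alpha>\<^sup>2"
            using assms n ratio large c by (intro lower_bound_le) auto
          then have lower: "?lower n \<le> \<sigma>\<^sup>2 * (\<Sum>u<N. (W n v u)\<^sup>2)"
            unfolding mult.commute[of "\<sigma>\<^sup>2"]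
            using sum_W_sq_ge_\<alpha>_sq[OF v n] sum_W_sq_ge_inverse[OF v, of n]
            by (intro mult_right_mono max.boundedI) auto
          have "\<sigma>\<^sup>2 * (\<Sum>u<N. (W n v u)\<^sup>2) \<le> \<sigma>\<^sup>2 * 1"
            using sum_W_sq_le_1[OF v] by (intro mult_left_mono) auto
          then have upper_1: "\<sigma>\<^sup>2 * (\<Sum>u<N. (W n v u)\<^sup>2) \<le> \<sigma>\<^sup>2"
            by (simp only: mult_1_right)
          have "\<sigma>\<^sup>2 * (\<Sum>u<N. (W n v u)\<^sup>2) \<le> \<sigma>\<^sup>2 * (\<alpha>\<^sup>2 + 1 / (real N * p N / 8))"
            using sum_W_sq_le[OF v n] by (intro mult_left_mono) auto
          also have "\<dots> \<le> (\<alpha> * (\<Sum>k<n. (1 - \<alpha>) ^ k * sqrt (var_upper N (p N) (q N) \<sigma> k))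
                  + (1 - \<alpha>) ^ n * sqrt (var_upper N (p N) (q N) \<sigma> n))\<^sup>2"
            using assms(1-3) n ratio large c N pq by (intro upper_bound_ge) auto
          finally show ?thesis
            unfolding V using lower upper_1 by (intro conjI min.boundedI)
        qed
        then show ?thesis
          using degree_pos by auto
      qed
      \<comment> \<open>The inclusion is known only on the support, hence the almost-everywhere form
        of monotonicity.\<close>
      then have "measure_pmf.prob ?G {A. \<forall>v<N. real N * p N / 8 \<le> node_degree N A v}
          \<le> measure_pmf.prob ?G ?E"
        by (intro measure_pmf.finite_measure_mono_AE) (auto simp: AE_measure_pmf_iff)
      moreover have "1 - 1 / real N
          \<le> measure_pmf.prob ?G {A. \<forall>v<N. real N * p N / 8 \<le> node_degree N A v}"
        using N C pq large by (intro csbm_min_degree) auto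
      moreover have "1 / real N \<le> K / real N"
        by (intro divide_right_mono) (auto simp: K_def)
      ultimately show ?thesis
        by linarith
    qed
  qed
qed

end
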